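(* $\mathfrak{p}\subset\mathbb{M}$ is a finite additive prime set if and only if there is a rooted tree $T$ with $|T|=|\mathfrak{p}|$ such that $\mathfrak{p}\in\Lambda(T)$.
   Context: $\mathbb{M}$ is the free magma on one generator $1$ (its elements are identified with finite full binary trees), with operation $+$. A set $\mathfrak{p}\subseteq\mathbb{M}$ is an additive prime set iff for all $x,y\in\mathbb{M}$, $x+y\in\mathfrak{p}$ implies $x\in\mathfrak{p}$ or $y\in\mathfrak{p}$. Terms: fix an infinite set of variables $a,b,c,\ldots$. Terms are formal strings defined recursively: $1$ and each variable is a term; if $x,y$ are terms then $(x\pm y)$ is a term. Let $\mathscr{L}$ be the set of terms. A substitution is a map $\sigma:\mathscr{L}\to\mathbb{M}$ such that $\sigma(1)=1$ and, for all terms $x,y$, $\sigma((x\pm y))$ is either $\sigma(x)+\sigma(y)$ or $\sigma(y)+\sigma(x)$ (the choice may depend on the term $(x\pm y)$, and the values on variables are arbitrary). Families: let $T$ be a rooted tree with root $r$, and $|T|$ its number of vertices. A labelization $\mathrm{Lab}:T\to\mathscr{L}$ is defined recursively by $\mathrm{Lab}(r)=1$ and, if $y$ is a child of an already labelled vertex $x$, $\mathrm{Lab}(y)=(a\pm\mathrm{Lab}(x))$ where $a$ is a new variable never used before. The family of $T$ is $\Lambda(T)=\{\sigma(\mathrm{Lab}(T))\mid\sigma\text{ a substitution}\}$, where $\sigma(\mathrm{Lab}(T))=\{\sigma(\mathrm{Lab}(v))\mid v\in T\}$; it does not depend on the choice of labelization.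
   Formalization: The additive prime set is required to be nonempty: the empty set is vacuously a finite additive prime set, but a rooted tree has a root, so it lies in no family. Trees are finite, with natural numbers as vertices (no loss up to isomorphism). *)

theory Defs
  imports Main
begin

section \<open>The free magma on one generator\<close>

datatype magma = Gen | Plus magma magma (infixl \<open>\<oplus>\<close> 65)

definition additive_prime_set :: "magma set \<Rightarrow> bool" where
  "additive_prime_set p \<longleftrightarrow> (\<forall>x y. x \<oplus> y \<in> p \<longrightarrow> x \<in> p \<or> y \<in> p)"

section \<open>Terms and substitutions\<close>

datatype tm = One | Var nat | PM tm tm

text \<open>A substitution is defined on terms, not only on variables: every occurrence of the same
  term \<open>PM x y\<close> is evaluated in the same order, but different terms may use different orders.\<close>

definition substitution :: "(tm \<Rightarrow> magma) \<Rightarrow> bool" where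
  "substitution \<sigma> \<longleftrightarrow> \<sigma> One = Gen \<and>
     (\<forall>x y. \<sigma> (PM x y) = \<sigma> x \<oplus> \<sigma> y \<or> \<sigma> (PM x y) = \<sigma> y \<oplus> \<sigma> x)"

section \<open>Rooted trees and their families\<close>

text \<open>Edges are directed from parent to child. Trees are finite, and have at least one vertex,
  namely the root.\<close>

record 'v rgraph =
  vertices :: "'v set"
  edges :: "('v \<times> 'v) set"
  root :: 'v

definition rooted_tree :: "'v rgraph \<Rightarrow> bool" where
  "rooted_tree T \<longleftrightarrow>
     finite (vertices T) \<and>
     edges T \<subseteq> vertices T \<times> vertices T \<and>
     root T \<in> vertices T \<and>
     (\<forall>x. (x, root T) \<notin> edges T) \<and>
     (\<forall>y \<in> vertices T - {root T}. \<exists>!x. (x, y) \<in> edges T) \<and>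
     (\<forall>y \<in> vertices T. (root T, y) \<in> (edges T)\<^sup>*)"

text \<open>The variable introduced at a non-root vertex \<open>y\<close> is \<open>a y\<close>; that it has never been used
  before is the injectivity of \<open>a\<close>.\<close>

definition labelization :: "'v rgraph \<Rightarrow> ('v \<Rightarrow> tm) \<Rightarrow> bool" where
  "labelization T Lab \<longleftrightarrow> Lab (root T) = One \<and>
     (\<exists>a. inj_on a (vertices T - {root T}) \<and>
          (\<forall>x y. (x, y) \<in> edges T \<longrightarrow> Lab y = PM (Var (a y)) (Lab x)))"

text \<open>All labelizations yield the same sets, so the union over them is the family obtained from
  any single one.\<close>

definition family :: "'v rgraph \<Rightarrow> magma set set" (\<open>\<Lambda>\<close>) where
  "\<Lambda> T = {\<sigma> ` Lab ` vertices T | \<sigma> Lab. substitution \<sigma> \<and> labelization T Lab}"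

end

theory Submission
  imports Defs
begin

text \<open>Every element of a prime set other than \<open>1\<close> has a summand in the set. Choosing one such
  summand as its parent turns a finite prime set into a tree rooted at \<open>1\<close>, and the new variable
  introduced at a vertex stands for the other summand. Conversely, the value at a non-root vertex is
  a sum in which the value at the parent is a summand, and sums in the free magma decompose uniquely.\<close>

lemma family_additive_prime_set:
  assumes T: "rooted_tree T" and p: "p \<in> \<Lambda> T"
  shows "finite p \<and> additive_prime_set p \<and> p \<noteq> {}"
proof -
  obtain \<sigma> Lab a where p_eq: "p = \<sigma> ` Lab ` vertices T" and sub: "substitution \<sigma>"
    and Lab_root: "Lab (root T) = One"
    and Lab_edge: "\<And>x y. (x, y) \<in> edges T \<Longrightarrow> Lab y = PM (Var (a y)) (Lab x)"
    using p unfolding family_def labelization_def by auto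
  have "x \<in> p \<or> y \<in> p" if xy: "x \<oplus> y \<in> p" for x y
  proof -
    obtain v where v: "v \<in> vertices T" "\<sigma> (Lab v) = x \<oplus> y"
      using xy p_eq by auto
    \<comment> \<open>The root has value \<open>Gen\<close>, which is not a sum.\<close>
    have "v \<noteq> root T"
      using v(2) Lab_root sub by (auto simp: substitution_def)
    then obtain u where u: "(u, v) \<in> edges T"
      using T v(1) unfolding rooted_tree_def by blast
    then have "\<sigma> (Lab u) \<in> p"
      using T p_eq unfolding rooted_tree_def by blast
    moreover have "\<sigma> (Lab v) = \<sigma> (Var (a v)) \<oplus> \<sigma> (Lab u) \<or> \<sigma> (Lab v) = \<sigma> (Lab u) \<oplus> \<sigma> (Var (a v))"
      using sub Lab_edge[OF u] unfolding substitution_def by simp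
    ultimately show ?thesis
      using v(2) by auto
  qed
  then show ?thesis
    using T p_eq unfolding rooted_tree_def additive_prime_set_def by auto
qed

text \<open>Passing repeatedly to a summand in \<open>p\<close> can only stop at
  \<open>Gen\<close>.\<close>

lemma Gen_mem_additive_prime_set:
  assumes "additive_prime_set p" "m \<in> p"
  shows "Gen \<in> p"
  using assms(2)
  by (induction m) (use assms(1) in \<open>auto simp: additive_prime_set_def\<close>)

text \<open>\<open>g\<close> numbers the elements of \<open>p\<close>, and \<open>e\<close> is its inverse.\<close>

primrec label :: "magma set \<Rightarrow> (magma \<Rightarrow> nat) \<Rightarrow> magma \<Rightarrow> tm" where
  "label p g Gen = One"
| "label p g (x \<oplus> y) = PM (Var (g (x \<oplus> y))) (if x \<in> p then label p g x else label p g y)"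

text \<open>The variable of a vertex encodes, through \<open>e\<close>, the whole sum there: it
  determines both the summand that is not the parent and the side on which the parent stands. The
  other cases are arbitrary defaults that make the map total.\<close>

primrec interp :: "magma set \<Rightarrow> (nat \<Rightarrow> magma) \<Rightarrow> tm \<Rightarrow> magma" where
  "interp p e One = Gen"
| "interp p e (Var i) = (case e i of Gen \<Rightarrow> Gen | x \<oplus> y \<Rightarrow> if x \<in> p then y else x)"
| "interp p e (PM s t) =
     (if \<exists>i x y. s = Var i \<and> e i = x \<oplus> y \<and> x \<in> p
      then interp p e t \<oplus> interp p e s else interp p e s \<oplus> interp p e t)"

lemma substitution_interp: "substitution (interp p e)"
  by (simp add: substitution_def)

text \<open>Induction along the chosen summands: \<open>label\<close> and \<open>interp\<close> both
  prefer the left summand when it lies in \<open>p\<close>, so the two parts are put back in their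
  original order.\<close>

lemma interp_label:
  assumes prime: "additive_prime_set p" and e_g: "\<And>m. m \<in> p \<Longrightarrow> e (g m) = m"
  shows "m \<in> p \<Longrightarrow> interp p e (label p g m) = m"
proof (induction m)
  case (Plus x y)
  then have "x \<in> p \<or> y \<in> p"
    using prime by (auto simp: additive_prime_set_def)
  then show ?case
    using Plus e_g by auto
qed simp

text \<open>Parents follow the same preference for the left summand as \<open>label\<close>.\<close>

definition summand_tree :: "magma set \<Rightarrow> (magma \<Rightarrow> nat) \<Rightarrow> nat rgraph" where
  "summand_tree p g = \<lparr>vertices = g ` p,
     edges = {(g (if x \<in> p then x else y), g (x \<oplus> y)) | x y. x \<oplus> y \<in> p},
     root = g Gen\<rparr>"

lemma rooted_tree_summand_tree:
  assumes fin: "finite p" and prime: "additive_prime_set p" and "p \<noteq> {}" and inj: "inj_on g p"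
  shows "rooted_tree (summand_tree p g)"
proof -
  let ?E = "edges (summand_tree p g)"
  have Gen: "Gen \<in> p"
    using Gen_mem_additive_prime_set prime \<open>p \<noteq> {}\<close> by blast
  have summand: "(if x \<in> p then x else y) \<in> p" if "x \<oplus> y \<in> p" for x y
    using prime that by (auto simp: additive_prime_set_def)
  \<comment> \<open>Injectivity of \<open>g\<close> on \<open>p\<close> recovers the sum from its
    number, and a sum determines its summands.\<close>
  have edge_iff: "(u, g (x \<oplus> y)) \<in> ?E \<longleftrightarrow> u = g (if x \<in> p then x else y)" if "x \<oplus> y \<in> p" for u x y
    using inj_onD[OF inj] that by (fastforce simp: summand_tree_def)
  have reach: "m \<in> p \<Longrightarrow> (g Gen, g m) \<in> ?E\<^sup>*" for m
  proof (induction m)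
    case (Plus x y)
    then have "(g Gen, g (if x \<in> p then x else y)) \<in> ?E\<^sup>*"
      using summand[OF Plus.prems] by (auto split: if_splits)
    then show ?case
      using edge_iff[OF Plus.prems] by (blast intro: rtrancl_into_rtrancl)
  qed simp
  have parent: "\<exists>!u. (u, v) \<in> ?E" if v: "v \<in> g ` p - {g Gen}" for v
  proof -
    obtain m where m: "m \<in> p" "v = g m" "m \<noteq> Gen"
      using v by blast
    then obtain x y where "m = x \<oplus> y"
      by (cases m) auto
    then show ?thesis
      using m edge_iff by simp
  qed
  \<comment> \<open>Edges end only at numbers of sums in \<open>p\<close>, and \<open>g\<close>
    separates these from \<open>Gen\<close>.\<close>
  have no_parent: "(u, g Gen) \<notin> ?E" for u
    using inj_onD[OF inj] Gen by (fastforce simp: summand_tree_def)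
  have "?E \<subseteq> g ` p \<times> g ` p"
    by (auto simp: summand_tree_def intro!: imageI summand split del: if_split)
  then show ?thesis
    using fin Gen reach parent no_parent
    by (simp add: rooted_tree_def) (simp add: summand_tree_def)
qed

lemma additive_prime_set_mem_family:
  assumes prime: "additive_prime_set p" and "p \<noteq> {}" and inj: "inj_on g p"
  shows "p \<in> \<Lambda> (summand_tree p g)"
proof -
  let ?e = "inv_into p g"
  let ?Lab = "label p g \<circ> ?e"
  have e_g: "\<And>m. m \<in> p \<Longrightarrow> ?e (g m) = m"
    using inj by simp
  have Gen: "Gen \<in> p"
    using Gen_mem_additive_prime_set prime \<open>p \<noteq> {}\<close> by blast
  have "?Lab v = PM (Var v) (?Lab u)" if "(u, v) \<in> edges (summand_tree p g)" for u v
    using that prime e_g by (fastforce simp: summand_tree_def additive_prime_set_def split: if_splits)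
  \<comment> \<open>Vertices are already natural numbers, so each can index its own variable: the
    naming map is \<open>id\<close>.\<close>
  then have "labelization (summand_tree p g) ?Lab"
    using Gen e_g unfolding labelization_def
    by (intro conjI exI[of _ id]) (auto simp: summand_tree_def)
  moreover have "p = interp p ?e ` ?Lab ` vertices (summand_tree p g)"
    using interp_label[OF prime, of ?e g] e_g by (force simp: summand_tree_def image_image)
  ultimately show ?thesis
    using substitution_interp unfolding family_def by blast
qed

theorem theorem7p4:
  fixes p :: "magma set"
  shows "(finite p \<and> additive_prime_set p \<and> p \<noteq> {}) \<longleftrightarrow>
         (\<exists>T :: nat rgraph. rooted_tree T \<and> card (vertices T) = card p \<and> p \<in> \<Lambda> T)"
proof
  assume p: "finite p \<and> additive_prime_set p \<and> p \<noteq> {}"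
  then obtain g :: "magma \<Rightarrow> nat" where g: "inj_on g p"
    using finite_imp_inj_to_nat_seg by blast
  have "card (vertices (summand_tree p g)) = card p"
    using g by (simp add: summand_tree_def card_image)
  then show "\<exists>T :: nat rgraph. rooted_tree T \<and> card (vertices T) = card p \<and> p \<in> \<Lambda> T"
    using p g rooted_tree_summand_tree additive_prime_set_mem_family by blast
next
  assume "\<exists>T :: nat rgraph. rooted_tree T \<and> card (vertices T) = card p \<and> p \<in> \<Lambda> T"
  then show "finite p \<and> additive_prime_set p \<and> p \<noteq> {}"
    using family_additive_prime_set by blast
qed

end
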